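(* Let $V$ be a finite set with $|V| = n$, and suppose that $\mathcal G_1 \subset \mathcal G_2 \subset \mathcal G_3 \subset \binom{V}{2}$ and that $\mathcal G_1, \mathcal G_2, \mathcal G_3$ are rainbow triangle-free (RBT-free). Then $$|\mathcal G_1|\,|\mathcal G_2|\,|\mathcal G_3| \leq \lfloor n^2/4 \rfloor^3.$$
   Context: A graph on the vertex set $V$ is identified with its edge set, a subset of $\binom{V}{2}$ (the 2-element subsets of $V$), and $|\mathcal G|$ denotes the number of edges. A triangle is the set of three edges $\binom{T}{2}$ for some 3-element set $T \subset V$. Three graphs $\mathcal G_1, \mathcal G_2, \mathcal G_3 \subset \binom{V}{2}$ are called rainbow triangle-free (RBT-free) if there do not exist edges $E_1 \in \mathcal G_1$, $E_2 \in \mathcal G_2$, $E_3 \in \mathcal G_3$ such that $\{E_1, E_2, E_3\}$ is a triangle. *)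

theory Defs
  imports Complex_Main "HOL-Library.Ramsey"
begin

text \<open>
  A graph on \<open>V\<close> is its edge set, a subset of \<open>[V]\<^bsup>2\<^esup>\<close>,
  the library's notation for the set of 2-element subsets of \<open>V\<close>.
\<close>

definition triangle :: "'a set \<Rightarrow> 'a set set \<Rightarrow> bool" where
  "triangle V F \<longleftrightarrow> (\<exists>T \<in> [V]\<^bsup>3\<^esup>. F = [T]\<^bsup>2\<^esup>)"

definition rbt_free ::
  "'a set \<Rightarrow> 'a set set \<Rightarrow> 'a set set \<Rightarrow> 'a set set \<Rightarrow> bool" where
  "rbt_free V G1 G2 G3 \<longleftrightarrow>
     \<not> (\<exists>E1 \<in> G1. \<exists>E2 \<in> G2. \<exists>E3 \<in> G3. triangle V {E1, E2, E3})"

end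

theory Submission
  imports Defs
begin

text \<open>
  Let \<open>D\<close> be the maximum degree of \<open>G1\<close> and \<open>N\<close> the \<open>G1\<close>-neighbourhood of a vertex of degree \<open>D\<close>;
  \<open>N\<close> is independent in \<open>G3\<close>. Hall's theorem yields a set \<open>S\<close> of \<open>k\<close> vertices carrying a permutation
  along edges of \<open>G1\<close> with \<open>2 |G1| \<le> k D\<close>. If \<open>xy\<close> is an edge of \<open>G1\<close> then every vertex \<open>z\<close> sends at most two
  edges of the multigraph \<open>G2 + G3\<close> to \<open>{x, y}\<close>, hence at most \<open>k\<close> edges to \<open>S\<close>. Counting the edges
  outside \<open>S\<close> trivially, but using that \<open>N - S\<close> contains none, bounds \<open>|G2| + |G3|\<close> in terms of \<open>k\<close>
  and \<open>D\<close>, and AM-GM reduces the claim to a one-variable inequality.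
\<close>

section \<open>Hall's marriage theorem\<close>

text \<open>Halmos-Vaughan induction on \<open>card X\<close>. If some nonempty proper
  \<open>Y\<close> is tight, match \<open>Y\<close> first and then \<open>X - Y\<close> outside the
  neighbourhood \<open>U\<close> of \<open>Y\<close>. If none is tight, any \<open>x\<close> may
  take any \<open>y\<close> in \<open>N x\<close>: deleting \<open>y\<close> costs each remaining
  subset at most the one neighbour it has to spare.\<close>

lemma hall_marriage:
  assumes "finite X" and "\<And>x. x \<in> X \<Longrightarrow> finite (N x)"
    and "\<And>Y. Y \<subseteq> X \<Longrightarrow> card Y \<le> card (\<Union>(N ` Y))"
  shows "\<exists>f. inj_on f X \<and> (\<forall>x\<in>X. f x \<in> N x)"
  using assms
proof (induction "card X" arbitrary: X N rule: less_induct)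
  case less
  note fin = \<open>finite X\<close> and finN = less.prems(2) and hall = less.prems(3)
  consider "X = {}" 
    | (tight) Y where "Y \<subset> X" "Y \<noteq> {}" "card (\<Union>(N ` Y)) \<le> card Y"
    | (slack) "X \<noteq> {}" "\<And>Y. Y \<subset> X \<Longrightarrow> Y \<noteq> {} \<Longrightarrow> card Y < card (\<Union>(N ` Y))"
    by (metis not_le)
  then show ?case
  proof cases
    case 1
    then show ?thesis by simp
  next
    case tight
    define U where "U = \<Union>(N ` Y)"
    have finY: "finite Y" using tight(1) fin by (meson finite_subset psubset_imp_subset)
    have finU: "finite U" using finY finN tight(1) by (auto simp: U_def)
    have "\<exists>f. inj_on f Y \<and> (\<forall>x\<in>Y. f x \<in> N x)"
    proof (rule less.hyps)
      show "card Y < card X" using fin tight(1) by (rule psubset_card_mono)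
      show "finite Y" by fact
      show "finite (N x)" if "x \<in> Y" for x using that tight(1) finN by auto
      show "card Z \<le> card (\<Union>(N ` Z))" if "Z \<subseteq> Y" for Z using that tight(1) hall by auto
    qed
    then obtain f where f: "inj_on f Y" "\<And>x. x \<in> Y \<Longrightarrow> f x \<in> N x" by blast
    have "\<exists>f. inj_on f (X - Y) \<and> (\<forall>x\<in>X - Y. f x \<in> N x - U)"
    proof (rule less.hyps)
      show "card (X - Y) < card X" using fin tight(1,2) by (intro psubset_card_mono) auto
      show "finite (X - Y)" using fin by simp
      show "finite (N x - U)" if "x \<in> X - Y" for x using that finN by auto
      show "card Z \<le> card (\<Union>x\<in>Z. N x - U)" if Z: "Z \<subseteq> X - Y" for Z
      proof -
        have finZ: "finite Z" using Z fin by (meson finite_Diff finite_subset)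
        \<comment> \<open>Hall's condition for \<open>Y \<union> Z\<close>, less
          \<open>card U \<le> card Y\<close>, leaves \<open>Z\<close> enough neighbours outside
          \<open>U\<close>.\<close>
        have "card Y + card Z = card (Y \<union> Z)"
          using Z finY finZ by (intro card_Un_disjoint [symmetric]) auto
        also have "\<dots> \<le> card (\<Union>(N ` (Y \<union> Z)))" using Z tight(1) by (intro hall) auto
        also have "\<Union>(N ` (Y \<union> Z)) = U \<union> (\<Union>x\<in>Z. N x - U)" by (auto simp: U_def)
        also have "card \<dots> \<le> card U + card (\<Union>x\<in>Z. N x - U)" by (rule card_Un_le)
        finally show ?thesis using tight(3) by (simp add: U_def)
      qed
    qed
    then obtain g where g: "inj_on g (X - Y)" "\<And>x. x \<in> X - Y \<Longrightarrow> g x \<in> N x - U" by blast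
    have "f x \<in> U" if "x \<in> Y" for x using f(2) that by (auto simp: U_def)
    then have ne: "f x \<noteq> g z" "g z \<noteq> f x" if "x \<in> Y" "z \<in> X - Y" for x z
      using g(2) [OF that(2)] that by (metis DiffD2)+
    have "inj_on (\<lambda>x. if x \<in> Y then f x else g x) X"
    proof (rule inj_onI)
      fix a b
      assume ab: "a \<in> X" "b \<in> X" "(if a \<in> Y then f a else g a) = (if b \<in> Y then f b else g b)"
      show "a = b"
      proof (cases "a \<in> Y"; cases "b \<in> Y")
        assume "a \<in> Y" "b \<in> Y"
        then show ?thesis using ab f(1) by (simp add: inj_on_eq_iff)
      next
        assume "a \<notin> Y" "b \<notin> Y"
        then show ?thesis using ab g(1) by (simp add: inj_on_eq_iff)
      qed (use ab ne in auto)
    qed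
    with f(2) g(2) show ?thesis
      by (intro exI [of _ "\<lambda>x. if x \<in> Y then f x else g x"]) auto
  next
    case slack
    then obtain x where x: "x \<in> X" by blast
    have "card {x} \<le> card (\<Union>(N ` {x}))" using x by (intro hall) auto
    then have "N x \<noteq> {}" by auto
    then obtain y where y: "y \<in> N x" by blast
    have "\<exists>f. inj_on f (X - {x}) \<and> (\<forall>z\<in>X - {x}. f z \<in> N z - {y})"
    proof (rule less.hyps)
      show "card (X - {x}) < card X" using fin x by (intro psubset_card_mono) auto
      show "finite (X - {x})" using fin by simp
      show "finite (N z - {y})" if "z \<in> X - {x}" for z using that finN by auto
      show "card Z \<le> card (\<Union>z\<in>Z. N z - {y})" if Z: "Z \<subseteq> X - {x}" for Z
      proof (cases "Z = {}")
        case False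
        have "card Z < card (\<Union>(N ` Z))" using Z False x by (intro slack(2)) auto
        moreover have "(\<Union>z\<in>Z. N z - {y}) = \<Union>(N ` Z) - {y}" by auto
        ultimately show ?thesis by (auto simp: card_Diff_singleton_if)
      qed simp
    qed
    then obtain f where f: "inj_on f (X - {x})" "\<And>z. z \<in> X - {x} \<Longrightarrow> f z \<in> N z - {y}" by blast
    then have "inj_on (f(x := y)) X" by (auto simp: inj_on_def)
    with f(2) y show ?thesis by (intro exI [of _ "f(x := y)"]) auto
  qed
qed

section \<open>Edges and degree sums\<close>

lemma nsets_2_edge:
  assumes "G \<subseteq> [V]\<^bsup>2\<^esup>" and "{x, y} \<in> G"
  shows "x \<in> V" and "y \<in> V" and "x \<noteq> y"
proof -
  have "{x, y} \<in> [V]\<^bsup>2\<^esup>" using assms by (rule subsetD)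
  then show "x \<in> V" "y \<in> V" "x \<noteq> y" by (auto simp: nsets_def)
qed

lemma finite_edges: "finite V \<Longrightarrow> G \<subseteq> [V]\<^bsup>2\<^esup> \<Longrightarrow> finite G"
  by (meson finite_imp_finite_nsets finite_subset)

lemma handshake:
  assumes "finite V" and "G \<subseteq> [V]\<^bsup>2\<^esup>"
  shows "(\<Sum>x\<in>V. card {y \<in> V. {x, y} \<in> G}) = 2 * card G"
proof -
  have "(\<Sum>x\<in>V. card {y \<in> V. {x, y} \<in> G}) = card (SIGMA x:V. {y \<in> V. {x, y} \<in> G})"
    using assms by (simp add: card_SigmaI)
  \<comment> \<open>Ordered pairs are grouped by the edge they span; each edge is spanned by
    two.\<close>
  also have "(SIGMA x:V. {y \<in> V. {x, y} \<in> G}) = (\<Union>e\<in>G. {(x, y). {x, y} = e})"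
    using nsets_2_edge [OF assms(2)] by auto
  also have "card \<dots> = (\<Sum>e\<in>G. card {(x, y). {x, y} = e})"
  proof (rule card_UN_disjoint)
    show "finite G" using assms by (rule finite_edges)
    show "\<forall>e\<in>G. finite {(x, y). {x, y} = e}"
    proof
      fix e assume "e \<in> G"
      then have "{(x, y). {x, y} = e} \<subseteq> V \<times> V" using nsets_2_edge [OF assms(2)] by auto
      then show "finite {(x, y). {x, y} = e}" using assms(1) by (meson finite_SigmaI finite_subset)
    qed
  qed auto
  also have "\<dots> = (\<Sum>e\<in>G. 2)"
  proof (rule sum.cong)
    fix e assume "e \<in> G"
    then have "e \<in> [V]\<^bsup>2\<^esup>" using assms(2) by blast
    then obtain a b where ab: "e = {a, b}" "a \<noteq> b" by (auto simp: nsets_def card_2_iff)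
    then have "{(x, y). {x, y} = e} = {(a, b), (b, a)}" by (auto simp: doubleton_eq_iff)
    then show "card {(x, y). {x, y} = e} = 2" using ab by simp
  qed simp
  finally show ?thesis by simp
qed

lemma handshake_real:
  assumes "finite V" and "G \<subseteq> [V]\<^bsup>2\<^esup>"
  shows "(\<Sum>x\<in>V. \<Sum>y\<in>V. of_bool ({x, y} \<in> G)) = (2 * card G :: real)"
proof -
  have "(\<Sum>x\<in>V. \<Sum>y\<in>V. of_bool ({x, y} \<in> G)) = (\<Sum>x\<in>V. real (card {y \<in> V. {x, y} \<in> G}))"
    using assms(1) by (simp add: Int_def of_bool_def sum.If_cases)
  also have "\<dots> = real (\<Sum>x\<in>V. card {y \<in> V. {x, y} \<in> G})" by simp
  also have "\<dots> = 2 * card G" by (simp add: handshake [OF assms])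
  finally show ?thesis .
qed

section \<open>Real inequalities and the optimisation of the parameters\<close>

text \<open>With \<open>s = p - t\<close>, right side minus left side is
  \<open>s * ((c + s\<^sup>2)\<^sup>2 - p * (2 * c * s + s ^ 3))\<close>, and the second factor is
  nonnegative because \<open>2 * p * s \<le> c + s\<^sup>2\<close> and \<open>p * s \<le> c\<close>.
  So the left side is largest at \<open>t = p\<close>.\<close>

lemma cubic_descent:
  fixes t p c :: real
  assumes "0 \<le> t" "t \<le> p" "p\<^sup>2 \<le> c"
  shows "t * (c + (p - t)\<^sup>2)\<^sup>2 \<le> p * c\<^sup>2"
proof -
  define s where "s = p - t"
  have s: "0 \<le> s" "s \<le> p" "0 \<le> p" using assms by (auto simp: s_def)
  have ps: "p * s \<le> c" using s assms(3) by (smt (verit) mult_left_mono power2_eq_square)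
  have c0: "0 \<le> c" using assms(3) by (smt (verit) zero_le_power2)
  have "2 * (p * s) \<le> p\<^sup>2 + s\<^sup>2" using sum_squares_bound [of p s] by simp
  also have "\<dots> \<le> c + 2 * s\<^sup>2" using assms(3) by (smt (verit) zero_le_power2)
  finally have "2 * (p * s) * c \<le> (c + s\<^sup>2) * c"
    using c0 assms(3) \<open>2 * (p * s) \<le> p\<^sup>2 + s\<^sup>2\<close> by (intro mult_right_mono) auto
  moreover have "(p * s) * s\<^sup>2 \<le> c * s\<^sup>2" using ps by (intro mult_right_mono) auto
  moreover have "0 \<le> s ^ 4" by simp
  ultimately have "p * (2 * c * s + s ^ 3) \<le> (c + s\<^sup>2)\<^sup>2"
    by (simp add: algebra_simps power2_eq_square power3_eq_cube power4_eq_xxxx)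
  then have "s * (p * (2 * c * s + s ^ 3)) \<le> s * (c + s\<^sup>2)\<^sup>2" using s by (intro mult_left_mono)
  then have "(p - s) * (c + s\<^sup>2)\<^sup>2 \<le> p * c\<^sup>2"
    by (simp add: algebra_simps power2_eq_square power3_eq_cube)
  then show ?thesis by (simp add: s_def)
qed

text \<open>AM-GM bounds \<open>b * c\<close> by the square of the mean of \<open>b\<close> and
  \<open>c\<close>; then \<open>cubic_descent\<close> applies with \<open>p * d\<close> as its
  \<open>c\<close>, since \<open>p \<le> d\<close> gives \<open>p\<^sup>2 \<le> p * d\<close>. In
  the application \<open>p + d\<close> is the number of vertices and \<open>t\<close> is, up to
  rounding, half of \<open>card S\<close>.\<close>

lemma product_bound:
  fixes a b c t p d :: real
  assumes "0 \<le> a" "0 \<le> b" "0 \<le> c" "0 \<le> t" "t \<le> p" "p \<le> d"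
    and "a \<le> t * d" and "b + c \<le> 2 * (p * d + (p - t)\<^sup>2)"
  shows "a * b * c \<le> (p * d) ^ 3"
proof -
  have "b * c \<le> ((b + c) / 2)\<^sup>2" using sum_squares_bound [of b c]
    by (simp add: power2_eq_square algebra_simps)
  also have "\<dots> \<le> (p * d + (p - t)\<^sup>2)\<^sup>2" using assms by (intro power_mono) auto
  finally have bc: "b * c \<le> (p * d + (p - t)\<^sup>2)\<^sup>2" .
  have "a * (b * c) \<le> t * d * (p * d + (p - t)\<^sup>2)\<^sup>2"
    using assms bc by (intro mult_mono) auto
  also have "\<dots> = d * (t * (p * d + (p - t)\<^sup>2)\<^sup>2)" by simp
  also have "\<dots> \<le> d * (p * (p * d)\<^sup>2)"
    using assms by (intro mult_left_mono cubic_descent) (auto simp: power2_eq_square mult_left_mono)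
  also have "\<dots> = (p * d) ^ 3" by (simp add: power2_eq_square power3_eq_cube)
  finally show ?thesis by simp
qed

text \<open>Here \<open>a\<close>, \<open>b\<close>, \<open>c\<close> stand for the sizes of
  \<open>G1\<close>, \<open>G2\<close>, \<open>G3\<close>, \<open>k\<close> for
  \<open>card S\<close>, \<open>D\<close> for the maximum degree of \<open>G1\<close> and
  \<open>q\<close> for \<open>card (N - S)\<close>. The witness splits \<open>n\<close> into parts
  \<open>p\<close> and \<open>n - p\<close>: balanced ones, unless \<open>2 * D\<close> exceeds
  \<open>n\<close>, when they are \<open>n - D\<close> and \<open>D\<close>.\<close>

lemma edge_count_optimisation:
  fixes n k D q a b c :: nat
  assumes "2 * a \<le> k * D" and "k \<le> n" and "k + 2 * D \<le> 2 * n" and "2 * D \<le> k + 2 * q"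
    and bc: "2 * (real b + real c) \<le>
      k * (2 * real n - k) + 2 * ((real n - k) * (real n - k - 1) - real q * (real q - 1))"
  shows "\<exists>p\<le>n. real a * real b * real c \<le> (real p * real (n - p)) ^ 3"
proof -
  define t where "t = real k / 2"
  have a: "real a \<le> t * D" using assms(1) by (simp add: t_def flip: of_nat_mult of_nat_le_iff)
  have k: "real k = 2 * t" by (simp add: t_def)
  have t: "0 \<le> t" by (simp add: t_def)
  have q: "0 \<le> real q * (real q - 1)" by (cases q) auto
  \<comment> \<open>When \<open>k = n\<close> is odd, the real bounds exceed the claim by a rounding error, and integrality of
    \<open>a\<close> and \<open>b + c\<close> is needed.\<close>
  consider (odd) m where "n = 2 * m + 1" "k = n" "D \<le> m"
    | (low) "D \<le> n div 2" "k \<le> 2 * (n div 2)" | (high) "n < 2 * D"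
  proof -
    have "(\<exists>m. n = 2 * m + 1 \<and> k = n \<and> D \<le> m) \<or> D \<le> n div 2 \<and> k \<le> 2 * (n div 2) \<or> n < 2 * D"
      using assms(2) by presburger
    then show ?thesis using that by blast
  qed
  then show ?thesis
  proof cases
    case odd
    have "2 * a \<le> (2 * m + 1) * m" using assms(1) odd by (meson le_trans mult_le_mono order_refl)
    then have "a \<le> m * (m + 1)" by (simp add: algebra_simps)
    then have 1: "real a \<le> real m * (real m + 1)"
      by (metis of_nat_1 of_nat_add of_nat_le_iff of_nat_mult)
    have "real (2 * (b + c)) \<le> real (n * n)" using bc q odd(2) by simp
    then have "2 * (b + c) \<le> n * n" by (simp only: of_nat_le_iff)
    then have "b + c \<le> 2 * (m * (m + 1))" using odd(1) by (simp add: algebra_simps)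
    then have "real (b + c) \<le> real (2 * (m * (m + 1)))" by (simp only: of_nat_le_iff)
    then have "real a * real b * real c \<le> (real m * (real m + 1)) ^ 3"
      using 1 by (intro product_bound [where t = "real m"]) (auto simp: algebra_simps)
    then show ?thesis using odd(1) by (intro exI [of _ m]) (simp add: algebra_simps)
  next
    case low
    define p where "p = n div 2"
    define d where "d = n - p"
    have n: "real n = p + d" and d: "d = p \<or> d = p + 1" by (auto simp: p_def d_def)
    have tp: "t \<le> p" using low(2) by (simp add: t_def p_def)
    have "t * D \<le> t * d" using low(1) t d by (intro mult_left_mono) (auto simp: p_def)
    \<comment> \<open>With \<open>q * (q - 1)\<close> bounded below by 0, the target exceeds the
      bound on \<open>b + c\<close> given by \<open>bc\<close> by
      \<open>(n - 2 * t) * (1 - (d - p))\<close>, which is nonnegative as \<open>d - p\<close> is 0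
      or 1.\<close>
    moreover have "real b + real c \<le> 2 * (real p * d + (p - t)\<^sup>2)"
      using bc q tp d unfolding k n by (auto simp: algebra_simps power2_eq_square)
    ultimately have "real a * real b * real c \<le> (real p * d) ^ 3"
      using a t tp d by (intro product_bound [where t = t]) auto
    then show ?thesis by (intro exI [of _ p]) (simp add: d_def p_def)
  next
    case high
    define p where "p = n - D"
    have D: "D \<le> n" using assms(3) by simp
    have n: "real n = p + real D" and pD: "n - p = D" "p < D" using high D by (auto simp: p_def)
    have tp: "t \<le> p" using assms(3) D by (simp add: t_def p_def of_nat_diff)
    have qD: "D - t \<le> q" using assms(4) by (simp add: t_def)
    \<comment> \<open>Unbalanced parts need the saving in \<open>q\<close>. Monotonicity holds as
      \<open>D - t \<ge> D - p \<ge> 1\<close>, and with \<open>D - t\<close> in place of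
      \<open>q\<close> the bound on \<open>b + c\<close> below has slack
      \<open>(p - t)\<^sup>2 + (p - t)\<close>.\<close>
    have "(D - t) * (D - t - 1) \<le> real q * (real q - 1)"
      using qD tp pD(2) by (intro mult_mono) auto
    then have "real b + real c \<le> 2 * (real p * D + (p - t)\<^sup>2)"
      using bc zero_le_power2 [of "p - t"] tp unfolding k n by (simp add: algebra_simps power2_eq_square)
    then have "real a * real b * real c \<le> (real p * D) ^ 3"
      using a t tp pD(2) by (intro product_bound [where t = t]) auto
    then show ?thesis using pD(1) by (intro exI [of _ p]) (simp add: p_def)
  qed
qed

section \<open>Permutations along edges\<close>

text \<open>The size bound is half-integral covering duality: for the sets \<open>I\<close>,
  \<open>J\<close>, \<open>R\<close> of the proof, weights 1 on \<open>J\<close>, 1/2 on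
  \<open>R\<close> and 0 on \<open>I\<close> give every edge total weight at least 1. They add up to
  half of \<open>card S\<close>, and each vertex meets at most \<open>D\<close> edges.\<close>

lemma perfect_2_matching_of_large_subset:
  fixes G :: "'a set set"
  assumes "finite V" and "G \<subseteq> [V]\<^bsup>2\<^esup>"
    and D: "\<And>x. x \<in> V \<Longrightarrow> card {y \<in> V. {x, y} \<in> G} \<le> D"
  shows "\<exists>S f. S \<subseteq> V \<and> bij_betw f S S \<and> (\<forall>x\<in>S. {x, f x} \<in> G) \<and> 2 * card G \<le> card S * D"
proof -
  define A where "A x = {y \<in> V. {x, y} \<in> G}" for x
  have sym: "y \<in> A x \<longleftrightarrow> x \<in> A y" if "x \<in> V" "y \<in> V" for x y
    using that by (auto simp: A_def insert_commute)
  have AV: "A x \<subseteq> V" for x by (auto simp: A_def)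
  have fin: "finite X" if "X \<subseteq> V" for X using that assms(1) by (rule finite_subset)
  \<comment> \<open>For an independent set \<open>I\<close> of maximum deficiency \<open>|I| - |N(I)|\<close>, maximality gives Hall's condition both for
    matching \<open>N(I)\<close> into \<open>I\<close> and for the permutation of the remaining vertices.\<close>
  define ind where "ind X \<longleftrightarrow> X \<subseteq> V \<and> X \<inter> \<Union>(A ` X) = {}" for X
  define def where "def X = int (card X) - int (card (\<Union>(A ` X)))" for X
  have fin_def: "finite (def ` {X. ind X})"
    by (rule finite_imageI, rule finite_subset [of _ "Pow V"]) (auto simp: ind_def assms(1))
  have "ind {}" by (simp add: ind_def)
  with fin_def have "Max (def ` {X. ind X}) \<in> def ` {X. ind X}" by (intro Max_in) auto
  then obtain I where I: "ind I" "Max (def ` {X. ind X}) = def I" by auto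
  have max: "def X \<le> def I" if "ind X" for X
    unfolding I(2) [symmetric] using that fin_def by (intro Max_ge) auto
  note I = I(1)
  define J where "J = \<Union>(A ` I)"
  define R where "R = V - I - J"
  have sub: "I \<subseteq> V" "J \<subseteq> V" "R \<subseteq> V" and disj: "I \<inter> J = {}" "R \<inter> I = {}" "R \<inter> J = {}"
    and V: "V = R \<union> J \<union> I"
    using I AV by (auto simp: ind_def J_def R_def)
  have AI: "A x \<subseteq> J" if "x \<in> I" for x using that by (auto simp: J_def)
  have RI: "y \<notin> A x" if "x \<in> R" "y \<in> I" for x y
  proof
    assume "y \<in> A x"
    then have "x \<in> A y" using sym [of x y] sub that by blast
    then show False using AI disj that by blast
  qed
  have "\<exists>h. inj_on h J \<and> (\<forall>x\<in>J. h x \<in> A x \<inter> I)"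
  proof (rule hall_marriage)
    show "card Y \<le> card (\<Union>x\<in>Y. A x \<inter> I)" if Y: "Y \<subseteq> J" for Y
    proof -
      \<comment> \<open>\<open>Z\<close> is the neighbourhood of \<open>Y\<close> in
        \<open>I\<close>. Removing it keeps \<open>I\<close> independent and drops all of
        \<open>Y\<close> from the neighbourhood, so the deficiency grows by at least
        \<open>card Y - card Z\<close>; by maximality this is at most 0.\<close>
      define Z where "Z = (\<Union>x\<in>Y. A x \<inter> I)"
      have Z: "Z \<subseteq> I" by (auto simp: Z_def)
      have "ind (I - Z)" using I by (auto simp: ind_def)
      then have "def (I - Z) \<le> def I" by (rule max)
      moreover have "\<Union>(A ` (I - Z)) \<subseteq> J - Y"
      proof
        fix y assume "y \<in> \<Union>(A ` (I - Z))"
        then obtain x where x: "x \<in> I" "x \<notin> Z" "y \<in> A x" by auto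
        then have "y \<in> J" using AI by auto
        moreover have "y \<notin> Y" using x sym [of x y] sub \<open>y \<in> J\<close> by (auto simp: Z_def)
        ultimately show "y \<in> J - Y" by simp
      qed
      then have "card (\<Union>(A ` (I - Z))) \<le> card (J - Y)" using fin sub by (intro card_mono) auto
      moreover have "card (J - Y) + card Y = card J"
        using Y fin [OF sub(2)] by (metis card_Diff_subset card_mono finite_subset le_add_diff_inverse2)
      moreover have "card (I - Z) + card Z = card I"
        using Z fin [OF sub(1)] by (metis card_Diff_subset card_mono finite_subset le_add_diff_inverse2)
      ultimately show ?thesis unfolding def_def Z_def [symmetric] J_def [symmetric] by linarith
    qed
  qed (use sub fin in auto)
  then obtain h where h: "inj_on h J" "\<And>x. x \<in> J \<Longrightarrow> h x \<in> A x" "\<And>x. x \<in> J \<Longrightarrow> h x \<in> I" by blast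
  have "\<exists>g. inj_on g R \<and> (\<forall>x\<in>R. g x \<in> A x \<inter> R)"
  proof (rule hall_marriage)
    show "card Y \<le> card (\<Union>x\<in>Y. A x \<inter> R)" if Y: "Y \<subseteq> R" for Y
    proof -
      define M where "M = (\<Union>x\<in>Y. A x \<inter> R)"
      \<comment> \<open>\<open>Z\<close> consists of the vertices of \<open>Y\<close> with no
        neighbour in \<open>Y\<close>. Adding it to \<open>I\<close> keeps independence and adds at
        most \<open>M - Y\<close> to the neighbourhood, so \<open>card Z \<le> card (M - Y)\<close>;
        adding \<open>card (Y \<inter> M)\<close> to both sides gives Hall's condition.\<close>
      define Z where "Z = Y - M"
      have MR: "M \<subseteq> R" by (auto simp: M_def)
      have ZR: "Z \<subseteq> R" "Z \<subseteq> Y" using Y by (auto simp: Z_def)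
      have AZ: "A z \<subseteq> J \<union> (M - Y)" if z: "z \<in> Z" for z
      proof
        fix y assume y: "y \<in> A z"
        then have yV: "y \<in> V" using AV by blast
        have "y \<notin> I" using RI z ZR y by blast
        moreover have "y \<in> M" if "y \<in> R" using that y z ZR by (auto simp: M_def)
        moreover have "y \<notin> Y"
        proof
          assume "y \<in> Y"
          moreover have "z \<in> R" using z ZR by blast
          moreover have "z \<in> A y" using \<open>z \<in> R\<close> y sym [of y z] yV sub by blast
          ultimately have "z \<in> M" by (auto simp: M_def)
          then show False using z by (simp add: Z_def)
        qed
        ultimately show "y \<in> J \<union> (M - Y)" using yV V by blast
      qed
      have "\<Union>(A ` (I \<union> Z)) \<subseteq> J \<union> (M - Y)" using AZ AI by blast
      moreover have "(I \<union> Z) \<inter> (J \<union> (M - Y)) = {}" using disj ZR MR by blast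
      ultimately have "ind (I \<union> Z)" using sub ZR by (auto simp: ind_def)
      then have "def (I \<union> Z) \<le> def I" by (rule max)
      moreover have "card (\<Union>(A ` (I \<union> Z))) \<le> card J + card (M - Y)"
      proof -
        have "card (\<Union>(A ` (I \<union> Z))) \<le> card (J \<union> (M - Y))"
          using \<open>\<Union>(A ` (I \<union> Z)) \<subseteq> J \<union> (M - Y)\<close> sub MR fin by (intro card_mono) auto
        also have "\<dots> \<le> card J + card (M - Y)" by (rule card_Un_le)
        finally show ?thesis .
      qed
      moreover have "card (I \<union> Z) = card I + card Z"
        using disj ZR sub fin by (intro card_Un_disjoint) auto
      moreover have "card Y = card Z + card (Y \<inter> M)" "card M = card (M - Y) + card (Y \<inter> M)"
        using card_Int_Diff [of Y M] card_Int_Diff [of M Y] Y MR sub fin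
        by (auto simp: Z_def Int_commute)
      ultimately show ?thesis unfolding def_def M_def [symmetric] J_def [symmetric] by linarith
    qed
  qed (use sub fin in auto)
  then obtain g where g: "inj_on g R" "\<And>x. x \<in> R \<Longrightarrow> g x \<in> A x" "\<And>x. x \<in> R \<Longrightarrow> g x \<in> R" by blast
  define S where "S = R \<union> (J \<union> h ` J)"
  \<comment> \<open>On \<open>R\<close> this follows \<open>g\<close>, which is onto
    \<open>R\<close> by finiteness; elsewhere it swaps each vertex of \<open>J\<close> with its
    partner under \<open>h\<close>.\<close>
  define f where "f x = (if x \<in> R then g x else if x \<in> J then h x else inv_into J h x)" for x
  have hJ: "h ` J \<subseteq> I" using h(3) by auto
  have "bij_betw f R R"
  proof -
    have "bij_betw g R R"
      using g fin sub endo_inj_surj [of R g] by (auto simp: bij_betw_def)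
    then show ?thesis by (rule bij_betw_cong [THEN iffD1, rotated]) (simp add: f_def)
  qed
  moreover have "bij_betw f J (h ` J)"
  proof -
    have "bij_betw h J (h ` J)" using h(1) by (rule inj_on_imp_bij_betw)
    moreover have "h x = f x" if "x \<in> J" for x using that disj by (auto simp: f_def)
    ultimately show ?thesis by (metis bij_betw_cong)
  qed
  moreover have "bij_betw f (h ` J) J"
  proof -
    have "bij_betw (inv_into J h) (h ` J) J" using h(1) by (simp add: bij_betw_inv_into inj_on_imp_bij_betw)
    moreover have "inv_into J h x = f x" if "x \<in> h ` J" for x using that hJ disj by (auto simp: f_def)
    ultimately show ?thesis by (metis bij_betw_cong)
  qed
  ultimately have "bij_betw f (R \<union> (J \<union> h ` J)) (R \<union> (h ` J \<union> J))"
    using disj hJ by (intro bij_betw_combine) blast+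
  then have 1: "bij_betw f S S" by (simp add: S_def Un_commute)
  have 2: "{x, f x} \<in> G" if x: "x \<in> S" for x
  proof -
    consider "x \<in> R" | "x \<in> J" | y where "y \<in> J" "x = h y" using x unfolding S_def by blast
    then show ?thesis
    proof cases
      case 1
      then show ?thesis using g(2) [of x] by (simp add: f_def A_def)
    next
      case 2
      then show ?thesis using h(2) [of x] disj by (auto simp add: f_def A_def)
    next
      case 3
      then have "f x = y" using hJ disj h(1) by (auto simp: f_def)
      then show ?thesis using h(2) [of y] 3 by (simp add: A_def insert_commute)
    qed
  qed
  have "card (J \<union> h ` J) = card J + card (h ` J)"
    using disj hJ sub fin by (intro card_Un_disjoint) auto
  moreover have "card S = card R + card (J \<union> h ` J)"
    unfolding S_def using disj hJ sub fin by (intro card_Un_disjoint) auto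
  ultimately have cS: "card S = card R + 2 * card J" using card_image [OF h(1)] by simp
  have AD: "(\<Sum>x\<in>X. card (A x)) \<le> card X * D" if "X \<subseteq> V" for X
    using that D by (intro sum_bounded_above [where 'a = nat, simplified]) (auto simp: A_def)
  \<comment> \<open>All neighbours of \<open>I\<close> lie in \<open>J\<close>, so reversing pairs
    embeds the incidences at \<open>I\<close> into those at \<open>J\<close>. Thus \<open>J\<close>
    is charged twice, matching \<open>2 * card J\<close> in \<open>cS\<close>.\<close>
  have "(\<Sum>x\<in>I. card (A x)) = card (SIGMA x:I. A x)"
    using sub fin AV by (simp add: card_SigmaI)
  also have "\<dots> = card (prod.swap ` (SIGMA x:I. A x))" by (simp add: card_image)
  also have "\<dots> \<le> card (SIGMA x:J. A x)"
  proof (rule card_mono)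
    show "finite (SIGMA x:J. A x)" using sub fin AV by auto
    show "prod.swap ` (SIGMA x:I. A x) \<subseteq> (SIGMA x:J. A x)"
    proof clarsimp
      fix x y assume xy: "x \<in> I" "y \<in> A x"
      then have "y \<in> J" using AI by blast
      moreover have "x \<in> A y" using xy sym [of x y] sub \<open>y \<in> J\<close> by blast
      ultimately show "y \<in> J \<and> x \<in> A y" by simp
    qed
  qed
  also have "\<dots> = (\<Sum>x\<in>J. card (A x))" using sub fin AV by (simp add: card_SigmaI)
  finally have "(\<Sum>x\<in>I. card (A x)) \<le> (\<Sum>x\<in>J. card (A x))" .
  moreover have "2 * card G = (\<Sum>x\<in>V. card (A x))"
    using handshake [OF assms(1,2)] by (simp add: A_def)
  moreover have "(\<Sum>x\<in>V. card (A x)) = (\<Sum>x\<in>R. card (A x)) + (\<Sum>x\<in>J. card (A x)) + (\<Sum>x\<in>I. card (A x))"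
  proof -
    have "(\<Sum>x\<in>R \<union> J. card (A x)) = (\<Sum>x\<in>R. card (A x)) + (\<Sum>x\<in>J. card (A x))"
      using disj sub fin by (intro sum.union_disjoint) auto
    moreover have "(\<Sum>x\<in>(R \<union> J) \<union> I. card (A x)) = (\<Sum>x\<in>R \<union> J. card (A x)) + (\<Sum>x\<in>I. card (A x))"
      using disj sub fin by (intro sum.union_disjoint) auto
    ultimately show ?thesis using V by simp
  qed
  ultimately have "2 * card G \<le> card S * D"
    using AD [OF sub(3)] AD [OF sub(2)] by (simp add: cS add_mult_distrib)
  moreover have "S \<subseteq> V" using sub hJ by (auto simp: S_def)
  ultimately show ?thesis using 1 2 by blast
qed

section \<open>Counting the edges of \<open>G2\<close> and \<open>G3\<close>, and the
  conclusion\<close>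

lemma sum_distinct_pairs:
  assumes "finite T" and "A \<subseteq> T"
  shows "(\<Sum>x\<in>T. \<Sum>y\<in>T. of_bool (x \<in> A \<and> y \<in> A \<and> x \<noteq> y)) = real (card A) * (real (card A) - 1)"
proof -
  have "(\<Sum>x\<in>T. \<Sum>y\<in>T. of_bool (x \<in> A \<and> y \<in> A \<and> x \<noteq> y)) =
      (\<Sum>x\<in>T. \<Sum>y\<in>T. of_bool (x \<in> A) * of_bool (y \<in> A) - of_bool (x \<in> A) * (if x = y then 1 else 0 :: real))"
    by (intro sum.cong) auto
  also have "\<dots> = (\<Sum>x\<in>T. of_bool (x \<in> A) * (real (card A) - 1))"
    using assms by (intro sum.cong)
      (simp_all add: sum_subtractf Int_absorb1 Int_def [symmetric] right_diff_distrib flip: sum_distrib_left)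
  also have "\<dots> = real (card A) * (real (card A) - 1)"
    using assms by (simp add: Int_absorb1 flip: sum_distrib_right)
  finally show ?thesis .
qed

lemma rbt_freeD:
  assumes "rbt_free V G1 G2 G3" and "x \<in> V" "y \<in> V" "z \<in> V" "x \<noteq> y" "x \<noteq> z" "y \<noteq> z"
    and "{x, y} \<in> G1" "{x, z} \<in> G2" "{y, z} \<in> G3"
  shows False
proof -
  have "{{x, y}, {x, z}, {y, z}} = [{x, y, z}]\<^bsup>2\<^esup>"
    using assms(5-7) by (auto simp: nsets_def card_2_iff doubleton_eq_iff)
  moreover have "{x, y, z} \<in> [V]\<^bsup>3\<^esup>" using assms(2-7) by (simp add: nsets_def)
  ultimately have "triangle V {{x, y}, {x, z}, {y, z}}" unfolding triangle_def by blast
  then show False using assms(1,8-10) unfolding rbt_free_def by blast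
qed

theorem theorem1p5:
  fixes V :: "'a set" and n :: nat and G1 G2 G3 :: "'a set set"
  assumes "finite V" and "card V = n"
    and "G1 \<subseteq> G2" and "G2 \<subseteq> G3" and "G3 \<subseteq> [V]\<^bsup>2\<^esup>"
    and "rbt_free V G1 G2 G3"
  shows "int (card G1) * int (card G2) * int (card G3) \<le> \<lfloor>(real n)^2 / 4\<rfloor> ^ 3"
proof (cases "V = {}")
  case True
  \<comment> \<open>There is no vertex of maximum degree to choose here, but all three graphs are
    empty.\<close>
  then have "[V]\<^bsup>2\<^esup> = {}" by (auto simp: nsets_def)
  then have "G3 = {}" using assms(5) by blast
  then show ?thesis by simp
next
  case False
  have sub: "G1 \<subseteq> [V]\<^bsup>2\<^esup>" "G2 \<subseteq> [V]\<^bsup>2\<^esup>" using assms(3-5) by auto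
  note rbt = rbt_freeD [OF assms(6)] and edge = nsets_2_edge [OF assms(5)]
  define deg where "deg x = card {y \<in> V. {x, y} \<in> G1}" for x
  have "Max (deg ` V) \<in> deg ` V" using False assms(1) by simp
  then obtain v where v: "v \<in> V" "deg v = Max (deg ` V)" by auto
  have deg: "deg x \<le> deg v" if "x \<in> V" for x using v that assms(1) by simp
  define N where "N = {y \<in> V. {v, y} \<in> G1}"
  have N: "N \<subseteq> V" "finite N" "deg v = card N" using assms(1) by (auto simp: N_def deg_def)
  \<comment> \<open>An edge \<open>{x, y}\<close> of \<open>G3\<close> would close a rainbow
    triangle with \<open>{v, x}\<close> from \<open>G1\<close> and \<open>{v, y}\<close> from
    \<open>G1 \<subseteq> G2\<close>.\<close>
  have indep: "{x, y} \<notin> G3" if "x \<in> N" "y \<in> N" for x y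
  proof
    assume "{x, y} \<in> G3"
    then show False
      using that edge [of x y] edge [of v x] edge [of v y] rbt [of v x y] assms(3,4) v
      by (auto simp: N_def)
  qed
  obtain S f where S: "S \<subseteq> V" "bij_betw f S S" "\<And>x. x \<in> S \<Longrightarrow> {x, f x} \<in> G1"
    and cG1: "2 * card G1 \<le> card S * deg v"
    using perfect_2_matching_of_large_subset [OF assms(1) sub(1), of "deg v"] deg
    unfolding deg_def by blast
  have fS: "f x \<in> S" if "x \<in> S" for x using S(2) that by (auto simp: bij_betw_def)
  have finS: "finite S" using S(1) assms(1) by (rule finite_subset)
  define w where "w x y = (of_bool ({x, y} \<in> G2) + of_bool ({x, y} \<in> G3) :: real)" for x y
  have w_sym: "w x y = w y x" for x y by (simp add: w_def insert_commute)
  have wS: "(\<Sum>x\<in>S. w z x) \<le> card S" if z: "z \<in> V" for z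
  proof -
    \<comment> \<open>Weight 2 means an edge of \<open>G2\<close>, and as \<open>{x, f x}\<close> is
      in \<open>G1\<close>, it forces weight 0 at the other end. If \<open>z\<close> is
      \<open>x\<close> or \<open>f x\<close>, the loop has weight 0 instead.\<close>
    have *: "w z x + w z (f x) \<le> 2" if x: "x \<in> S" for x
    proof -
      have xf: "{x, f x} \<in> G1" "x \<in> V" "f x \<in> V" using S x fS by auto
      show ?thesis
        using rbt [of x "f x" z] rbt [of "f x" x z] xf z edge [of z x] edge [of z "f x"]
          edge [of x "f x"] assms(3,4)
        by (auto simp: w_def of_bool_def insert_commute)
    qed
    \<comment> \<open>Since \<open>f\<close> permutes \<open>S\<close>, every vertex of
      \<open>S\<close> occurs once as \<open>x\<close> and once as \<open>f x\<close>.\<close>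
    have "2 * (\<Sum>x\<in>S. w z x) = (\<Sum>x\<in>S. w z x) + (\<Sum>x\<in>S. w z (f x))"
      by (simp add: sum.reindex_bij_betw [OF S(2)])
    also have "\<dots> = (\<Sum>x\<in>S. w z x + w z (f x))" by (simp add: sum.distrib)
    also have "\<dots> \<le> (\<Sum>x\<in>S. 2)" using * by (rule sum_mono)
    finally show ?thesis by simp
  qed
  define T where "T = V - S"
  define q where "q = card (N - S)"
  have T: "finite T" "V = S \<union> T" "S \<inter> T = {}" "N - S \<subseteq> T" using S(1) N(1) assms(1) by (auto simp: T_def)
  have cT: "card V = card S + card T" using T finS by (metis card_Un_disjoint)
  have cN: "card N = card (S \<inter> N) + q" using card_Int_Diff [of N S] N(2) by (simp add: q_def Int_commute)
  \<comment> \<open>\<open>f\<close> maps \<open>S \<inter> N\<close> injectively out of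
    \<open>N\<close>, as \<open>{x, f x}\<close> is an edge of \<open>G3\<close>. With
    \<open>k = card S\<close> and \<open>D = deg v\<close> this gives
    \<open>2 * D \<le> k + 2 * q\<close>, and with \<open>q \<le> card T\<close> also
    \<open>k + 2 * D \<le> 2 * n\<close>.\<close>
  have SN: "2 * card (S \<inter> N) \<le> card S"
  proof -
    have "card (S \<inter> N) = card (f ` (S \<inter> N))"
      using S(2) by (intro card_image [symmetric]) (auto simp: bij_betw_def intro: inj_on_subset)
    also have "\<dots> \<le> card (S - N)"
    proof (rule card_mono)
      show "f ` (S \<inter> N) \<subseteq> S - N" using fS S(3) indep assms(3,4) by blast
    qed (use finS in simp)
    finally show ?thesis using card_Int_Diff [of S N] finS by simp
  qed
  have "q \<le> card T" unfolding q_def using T by (intro card_mono) auto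
  have split: "(\<Sum>x\<in>V. u x) = (\<Sum>x\<in>S. u x) + (\<Sum>x\<in>T. u x)" for u :: "'a \<Rightarrow> real"
    unfolding T(2) using finS T by (intro sum.union_disjoint) auto
  have "{x} \<notin> G3" for x using edge(3) [of x x] by auto
  then have "(\<Sum>x\<in>T. \<Sum>y\<in>T. w x y) \<le> (\<Sum>x\<in>T. \<Sum>y\<in>T. 2 * (of_bool (x \<noteq> y) - of_bool (x \<in> N \<and> y \<in> N \<and> x \<noteq> y)))"
    using indep assms(4) by (intro sum_mono) (auto simp: w_def of_bool_def)
  also have "\<dots> = 2 * (real (card T) * (real (card T) - 1) - real q * (real q - 1))"
  proof -
    have "(\<Sum>x\<in>T. \<Sum>y\<in>T. of_bool (x \<noteq> y)) = real (card T) * (real (card T) - 1)"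
      using sum_distinct_pairs [OF T(1) order_refl] by simp
    moreover have "(\<Sum>x\<in>T. \<Sum>y\<in>T. of_bool (x \<in> N \<and> y \<in> N \<and> x \<noteq> y)) = real q * (real q - 1)"
    proof -
      have "x \<in> N - S \<longleftrightarrow> x \<in> N" if "x \<in> T" for x using that T(3) by blast
      then show ?thesis using sum_distinct_pairs [OF T(1,4)] by (simp add: q_def cong: sum.cong)
    qed
    ultimately show ?thesis by (simp add: sum_subtractf flip: sum_distrib_left)
  qed
  finally have wT: "(\<Sum>x\<in>T. \<Sum>y\<in>T. w x y) \<le> 2 * (real (card T) * (real (card T) - 1) - real q * (real q - 1))"
    .
  have "2 * (real (card G2) + real (card G3)) = (\<Sum>x\<in>V. \<Sum>y\<in>V. w x y)"
    using handshake_real [OF assms(1) sub(2)] handshake_real [OF assms(1,5)]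
    by (simp add: w_def sum.distrib)
  \<comment> \<open>By symmetry of \<open>w\<close>, the first two blocks are sums of the stars
    bounded in \<open>wS\<close>, and together contribute at most \<open>k * (2 * n - k)\<close> for
    \<open>k = card S\<close>; the last block is bounded by \<open>wT\<close>.\<close>
  also have "\<dots> = (\<Sum>x\<in>S. \<Sum>y\<in>V. w x y) + ((\<Sum>x\<in>T. \<Sum>y\<in>S. w x y) + (\<Sum>x\<in>T. \<Sum>y\<in>T. w x y))"
    by (subst (1) split) (simp add: split [of "w _"] sum.distrib)
  also have "(\<Sum>x\<in>S. \<Sum>y\<in>V. w x y) = (\<Sum>y\<in>V. \<Sum>x\<in>S. w y x)"
    by (subst sum.swap) (simp add: w_sym)
  finally have "2 * (real (card G2) + real (card G3)) =
    (\<Sum>y\<in>V. \<Sum>x\<in>S. w y x) + ((\<Sum>x\<in>T. \<Sum>y\<in>S. w x y) + (\<Sum>x\<in>T. \<Sum>y\<in>T. w x y))" .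
  moreover have "(\<Sum>y\<in>V. \<Sum>x\<in>S. w y x) \<le> real (card V) * real (card S)"
    using wS by (rule sum_bounded_above)
  moreover have "(\<Sum>x\<in>T. \<Sum>y\<in>S. w x y) \<le> real (card T) * real (card S)"
    using wS T(2) by (intro sum_bounded_above) blast
  ultimately have "2 * (real (card G2) + real (card G3)) \<le> real n * card S + real (card T) * card S
      + 2 * (real (card T) * (real (card T) - 1) - real q * (real q - 1))"
    using wT unfolding assms(2) by linarith
  moreover have "real n = card S + real (card T)" using cT assms(2) by simp
  ultimately have bc: "2 * (real (card G2) + real (card G3)) \<le> card S * (2 * real n - card S)
      + 2 * ((real n - card S) * (real n - card S - 1) - real q * (real q - 1))"
    by (simp add: algebra_simps)
  obtain p where p: "p \<le> n"
    and le: "real (card G1) * real (card G2) * real (card G3) \<le> (real p * real (n - p)) ^ 3"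
    using edge_count_optimisation [OF cG1 _ _ _ bc] cN cT SN N(3) \<open>q \<le> card T\<close> assms(2) by auto
  \<comment> \<open>AM-GM for \<open>p\<close> and \<open>n - p\<close>; the product is an integer,
    so it is also at most the floor.\<close>
  have "real_of_int (int (p * (n - p))) \<le> (real n)\<^sup>2 / 4"
    using sum_squares_bound [of "real p" "real (n - p)"] p
    by (simp add: of_nat_diff power2_eq_square algebra_simps)
  then have "int (p * (n - p)) \<le> \<lfloor>(real n)\<^sup>2 / 4\<rfloor>" by (simp only: le_floor_iff)
  then have "int (p * (n - p)) ^ 3 \<le> \<lfloor>(real n)\<^sup>2 / 4\<rfloor> ^ 3" by (intro power_mono) auto
  moreover have "card G1 * card G2 * card G3 \<le> (p * (n - p)) ^ 3"
    using le by (simp only: flip: of_nat_mult of_nat_power of_nat_le_iff)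
  then have "int (card G1) * int (card G2) * int (card G3) \<le> int (p * (n - p)) ^ 3"
    by (simp only: flip: of_nat_mult of_nat_power of_nat_le_iff)
  ultimately show ?thesis by linarith
qed

end
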